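(* Let $F$ be a differential field of characteristic zero whose field of constants $C$ is algebraically closed. Let $E$ be an iterated antiderivative extension of $F$ and let $K \supseteq F$ be a differential subfield of $E$. Then $K$ is an iterated antiderivative extension of $F$.
   Context: A differential field is a field with a derivation $'$; its constants are the elements $c$ with $c'=0$. A differential field extension $E$ of $F$ is a field extension whose derivation restricts to that of $F$; it is a no new constants extension if the constants of $E$ are the same as the constants of $F$. A differential subfield is a subfield closed under the derivation. Let $E$ be a no new constants extension of $F$. Elements $\zeta_1,\dots,\zeta_n\in E$ are iterated antiderivatives of $F$ if $\zeta_1'\in F$ and $\zeta_i'\in F(\zeta_1,\dots,\zeta_{i-1})$ for $i\ge 2$. $E$ is an iterated antiderivative extension of $F$ if $E$ is a no new constants extension of $F$ and $E=F(\zeta_1,\dots,\zeta_n)$ (field generation) for some finite list of iterated antiderivatives $\zeta_1,\dots,\zeta_n\in E$ of $F$ (the case $E=F$ is included). *)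

theory Defs
  imports "HOL-Computational_Algebra.Polynomial"
begin

text \<open>
  All fields are subsets of one type of class \<open>field\<close>, which supplies the operations, and all
  derivations are restrictions of one map \<open>D\<close>.  No condition is imposed on \<open>D\<close> outside the
  fields under consideration.
\<close>

definition is_subfield :: "'a::field set \<Rightarrow> bool" where
  "is_subfield F \<longleftrightarrow> 0 \<in> F \<and> 1 \<in> F \<and>
     (\<forall>x\<in>F. \<forall>y\<in>F. x + y \<in> F \<and> x * y \<in> F) \<and>
     (\<forall>x\<in>F. - x \<in> F) \<and> (\<forall>x\<in>F. x \<noteq> 0 \<longrightarrow> inverse x \<in> F)"

definition field_adjoin :: "'a::field set \<Rightarrow> 'a set \<Rightarrow> 'a set" where
  "field_adjoin F S = is_subfield hull (F \<union> S)"

definition alg_closed_subfield :: "'a::field set \<Rightarrow> bool" where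
  "alg_closed_subfield C \<longleftrightarrow> is_subfield C \<and>
     (\<forall>p. (\<forall>i. coeff p i \<in> C) \<longrightarrow> degree p > 0 \<longrightarrow> (\<exists>x\<in>C. poly p x = 0))"

definition differential_field :: "('a::field \<Rightarrow> 'a) \<Rightarrow> 'a set \<Rightarrow> bool" where
  "differential_field D F \<longleftrightarrow> is_subfield F \<and> (\<forall>x\<in>F. D x \<in> F) \<and>
     (\<forall>x\<in>F. \<forall>y\<in>F. D (x + y) = D x + D y \<and> D (x * y) = D x * y + x * D y)"

definition constants :: "('a::field \<Rightarrow> 'a) \<Rightarrow> 'a set \<Rightarrow> 'a set" where
  "constants D F = {c \<in> F. D c = 0}"

definition differential_subfield :: "('a::field \<Rightarrow> 'a) \<Rightarrow> 'a set \<Rightarrow> 'a set \<Rightarrow> bool" where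
  "differential_subfield D K E \<longleftrightarrow> K \<subseteq> E \<and> is_subfield K \<and> (\<forall>x\<in>K. D x \<in> K)"

definition differential_extension :: "('a::field \<Rightarrow> 'a) \<Rightarrow> 'a set \<Rightarrow> 'a set \<Rightarrow> bool" where
  "differential_extension D F E \<longleftrightarrow>
     differential_field D F \<and> differential_field D E \<and> F \<subseteq> E"

definition no_new_constants_extension :: "('a::field \<Rightarrow> 'a) \<Rightarrow> 'a set \<Rightarrow> 'a set \<Rightarrow> bool" where
  "no_new_constants_extension D F E \<longleftrightarrow>
     differential_extension D F E \<and> constants D E = constants D F"

text \<open>The list is 0-indexed: \<open>take i zs\<close> consists of the entries preceding \<open>zs ! i\<close>, and
  for \<open>i = 0\<close> the field on the right is \<open>F\<close> itself.\<close>

definition iterated_antiderivatives ::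
    "('a::field \<Rightarrow> 'a) \<Rightarrow> 'a set \<Rightarrow> 'a set \<Rightarrow> 'a list \<Rightarrow> bool" where
  "iterated_antiderivatives D F E zs \<longleftrightarrow>
     no_new_constants_extension D F E \<and> set zs \<subseteq> E \<and>
     (\<forall>i<length zs. D (zs ! i) \<in> field_adjoin F (set (take i zs)))"

definition iterated_antiderivative_extension ::
    "('a::field \<Rightarrow> 'a) \<Rightarrow> 'a set \<Rightarrow> 'a set \<Rightarrow> bool" where
  "iterated_antiderivative_extension D F E \<longleftrightarrow>
     no_new_constants_extension D F E \<and>
     (\<exists>zs. iterated_antiderivatives D F E zs \<and> E = field_adjoin F (set zs))"

lemma is_subfield_field_adjoin: "is_subfield (field_adjoin F S)"
  unfolding field_adjoin_def by (rule hull_in) (auto simp: is_subfield_def)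

lemma field_adjoin_empty: "is_subfield F \<Longrightarrow> field_adjoin F {} = F"
  by (simp add: field_adjoin_def hull_same)

lemma differential_subfield_imp_differential_field:
  "differential_field D E \<Longrightarrow> differential_subfield D K E \<Longrightarrow> differential_field D K"
  unfolding differential_field_def differential_subfield_def by (meson subsetD)

end

theory Submission
  imports Defs
begin

text \<open>
  The proof is by induction on the number of antiderivatives \<open>\<zeta>\<^sub>1, \<dots>, \<zeta>\<^sub>n\<close> generating \<open>E\<close> over \<open>F\<close>,
  for all intermediate \<open>K\<close> at once.  Put \<open>z = \<zeta>\<^sub>1\<close>.  Since \<open>E\<close> is generated over \<open>F(z)\<close> by
  \<open>n - 1\<close> antiderivatives, the induction hypothesis presents \<open>K(z)\<close> as a tower of antiderivatives
  \<open>w\<^sub>1, \<dots>, w\<^sub>m\<close> over \<open>F(z)\<close>.  If \<open>z \<in> K\<close>, then \<open>z, w\<^sub>1, \<dots>, w\<^sub>m\<close> is a tower for \<open>K\<close> over \<open>F\<close>.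

  If \<open>z \<notin> K\<close>, then \<open>z\<close> is transcendental over \<open>K\<close>, because an antiderivative that is algebraic
  differs from an element of \<open>K\<close> by a constant, and \<open>K\<close> contains all the constants of \<open>E\<close>
  (\<open>antiderivative_transcendental\<close>).  Let \<open>M\<close> be the set of those elements of \<open>K\<close> that lie in some
  finite tower of antiderivatives over \<open>F\<close> inside \<open>K\<close>.  It is a field between \<open>F\<close> and \<open>K\<close>, and an
  element of \<open>K\<close> with derivative in \<open>M\<close> is in \<open>M\<close>.  The heart of the proof
  (\<open>antiderivative_closed_adjoin\<close>) is that this closure property passes from \<open>M \<subseteq> K\<close> to
  \<open>M(z) \<subseteq> K(z)\<close>.  Consequently \<open>w\<^sub>1, \<dots>, w\<^sub>m\<close> lie in \<open>M(z)\<close>, one after the other.  Only finitely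
  many elements of \<open>M\<close> are involved in expressing them, so they lie in \<open>L(z)\<close> for the field \<open>L\<close> of a
  single tower over \<open>F\<close> inside \<open>K\<close>.  Hence \<open>K \<subseteq> L(z)\<close>, and \<open>K = L\<close> as \<open>z\<close> is transcendental over \<open>K\<close>.

  For the closure property, let \<open>u \<in> K(z)\<close> have derivative in \<open>M(z)\<close>, and expand
  \<open>u = \<Sum>\<^sub>i a\<^sub>i z\<^sup>i\<close> in descending powers of \<open>z\<close>.  The coefficient of \<open>z\<^sup>i\<close> in \<open>u'\<close> is
  \<open>a\<^sub>i' + (i + 1) z' a\<^bsub>i+1\<^esub>\<close>.  Working downwards from the highest power,
  \<open>a\<^bsub>i+1\<^esub> \<in> M\<close> gives \<open>a\<^sub>i' \<in> M\<close> and therefore \<open>a\<^sub>i \<in> M\<close>.  Finally, a rational function over \<open>K\<close> whose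
  expansion has all its coefficients in \<open>M\<close> is a rational function over \<open>M\<close>, since its possible
  denominators are the solutions of a linear system over \<open>M\<close> (\<open>rational_descent\<close>).  To stay within
  polynomials, the expansion of \<open>P / Q\<close> is represented by the quotients
  \<open>(z\<^sup>k P) div Q\<close> for all \<open>k\<close>: these are its truncations, shifted by \<open>z\<^sup>k\<close>.
\<close>

section \<open>Polynomials over a subfield\<close>

definition polys_over :: "'a::field set \<Rightarrow> 'a poly set" where
  "polys_over K = {p. \<forall>i. coeff p i \<in> K}"

lemma subfieldD:
  assumes "is_subfield K"
  shows "0 \<in> K" "1 \<in> K" "x \<in> K \<Longrightarrow> y \<in> K \<Longrightarrow> x + y \<in> K" "x \<in> K \<Longrightarrow> y \<in> K \<Longrightarrow> x * y \<in> K"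
    "x \<in> K \<Longrightarrow> - x \<in> K" "x \<in> K \<Longrightarrow> y \<in> K \<Longrightarrow> x - y \<in> K"
    "x \<in> K \<Longrightarrow> inverse x \<in> K" "x \<in> K \<Longrightarrow> y \<in> K \<Longrightarrow> x / y \<in> K"
proof -
  show inv: "inverse x \<in> K" if "x \<in> K" for x
    using assms that by (cases "x = 0") (auto simp: is_subfield_def)
  show "x - y \<in> K" if "x \<in> K" "y \<in> K" for x y
    using assms that unfolding is_subfield_def diff_conv_add_uminus by blast
  show "x / y \<in> K" if "x \<in> K" "y \<in> K" for x y
    using assms that inv[OF that(2)] unfolding is_subfield_def divide_inverse by blast
qed (use assms in \<open>auto simp: is_subfield_def\<close>)

lemma subfield_sum:
  assumes "is_subfield K" "\<And>i. i \<in> A \<Longrightarrow> f i \<in> K"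
  shows "sum f A \<in> K"
  using assms(2) by (induction A rule: infinite_finite_induct) (auto intro: subfieldD[OF assms(1)])

lemma subfield_of_nat: "is_subfield K \<Longrightarrow> of_nat n \<in> K"
  by (induction n) (auto intro: subfieldD)

lemma subfield_power: "is_subfield K \<Longrightarrow> x \<in> K \<Longrightarrow> x ^ n \<in> K"
  by (induction n) (auto intro: subfieldD)

context
  fixes K :: "'a::field set"
  assumes K: "is_subfield K"
begin

lemma polys_over_0: "0 \<in> polys_over K"
  by (simp add: polys_over_def subfieldD[OF K])

lemma polys_over_1: "1 \<in> polys_over K"
  by (simp add: polys_over_def subfieldD[OF K] coeff_1)

lemma polys_over_monom: "c \<in> K \<Longrightarrow> monom c n \<in> polys_over K"
  by (simp add: polys_over_def subfieldD[OF K])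

lemma polys_over_pCons_iff: "pCons c p \<in> polys_over K \<longleftrightarrow> c \<in> K \<and> p \<in> polys_over K"
  unfolding polys_over_def by (auto simp: coeff_pCons split: nat.splits)

lemma polys_over_add: "p \<in> polys_over K \<Longrightarrow> q \<in> polys_over K \<Longrightarrow> p + q \<in> polys_over K"
  by (simp add: polys_over_def subfieldD[OF K])

lemma polys_over_diff: "p \<in> polys_over K \<Longrightarrow> q \<in> polys_over K \<Longrightarrow> p - q \<in> polys_over K"
  by (simp add: polys_over_def subfieldD[OF K])

lemma polys_over_uminus: "p \<in> polys_over K \<Longrightarrow> - p \<in> polys_over K"
  by (simp add: polys_over_def subfieldD[OF K])

lemma polys_over_mult: "p \<in> polys_over K \<Longrightarrow> q \<in> polys_over K \<Longrightarrow> p * q \<in> polys_over K"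
  by (simp add: polys_over_def coeff_mult subfield_sum[OF K] subfieldD[OF K])

lemma polys_over_smult: "c \<in> K \<Longrightarrow> p \<in> polys_over K \<Longrightarrow> smult c p \<in> polys_over K"
  by (simp add: polys_over_def subfieldD[OF K])

lemma polys_over_sum: "(\<And>i. i \<in> A \<Longrightarrow> f i \<in> polys_over K) \<Longrightarrow> sum f A \<in> polys_over K"
  by (simp add: polys_over_def coeff_sum subfield_sum[OF K])

lemma polys_over_poly: "p \<in> polys_over K \<Longrightarrow> x \<in> K \<Longrightarrow> poly p x \<in> K"
  by (induction p) (auto simp: polys_over_pCons_iff intro: subfieldD[OF K])

lemma polys_over_div:
  assumes "p \<in> polys_over K" and Q: "q \<in> polys_over K"
  shows "p div q \<in> polys_over K"
proof (cases "q = 0")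
  case False
  from assms(1) show ?thesis
  proof (induction "degree p" arbitrary: p rule: less_induct)
    case less
    show ?case
    proof (cases "degree p < degree q \<or> p = 0")
      case True
      then show ?thesis by (auto simp: div_poly_less polys_over_0)
    next
      case p: False
      define t where "t = monom (lead_coeff p / lead_coeff q) (degree p - degree q)"
      define p1 where "p1 = p - t * q"
      have t: "t \<in> polys_over K"
        unfolding t_def using less.prems Q
        by (intro polys_over_monom subfieldD[OF K]) (auto simp: polys_over_def)
      have p1: "p1 \<in> polys_over K"
        unfolding p1_def using less.prems Q t by (intro polys_over_diff polys_over_mult)
      have "p div q = (p1 + t * q) div q" by (simp add: p1_def)
      also have "\<dots> = p1 div q + t"
        using False by (simp add: poly_div_add_left)
      finally have eq: "p div q = p1 div q + t" .
      have "p1 div q \<in> polys_over K"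
      proof (cases "p1 = 0")
        case True
        then show ?thesis by (simp add: polys_over_0)
      next
        case p10: False
        have tz: "t \<noteq> 0" using p False by (simp add: t_def)
        have "degree t = degree p - degree q"
          unfolding t_def using p False by (intro degree_monom_eq) simp
        then have dt: "degree (t * q) = degree p"
          using tz False p by (simp add: degree_mult_eq)
        have lt: "lead_coeff (t * q) = lead_coeff p"
          using False by (simp add: lead_coeff_mult t_def lead_coeff_monom del: coeff_monom)
        have "degree p1 < degree p"
        proof -
          have "coeff p1 (degree p) = 0" using dt lt by (simp add: p1_def)
          moreover have "degree p1 \<le> degree p"
            unfolding p1_def by (rule degree_diff_le) (simp_all add: dt)
          ultimately show ?thesis using p10 by (metis le_neq_implies_less leading_coeff_0_iff)
        qed
        then show ?thesis using less.hyps p1 by blast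
      qed
      then show ?thesis unfolding eq using t by (rule polys_over_add)
    qed
  qed
qed (simp add: polys_over_0)

lemma polys_over_mod: "p \<in> polys_over K \<Longrightarrow> q \<in> polys_over K \<Longrightarrow> p mod q \<in> polys_over K"
  by (simp add: minus_div_mult_eq_mod[symmetric] polys_over_div polys_over_diff polys_over_mult)

end

lemma polys_over_mono: "K \<subseteq> L \<Longrightarrow> polys_over K \<subseteq> polys_over L"
  unfolding polys_over_def by blast

section \<open>Adjoining elements to a subfield\<close>

lemma field_adjoin_superset: "F \<union> S \<subseteq> field_adjoin F S"
  unfolding field_adjoin_def by (rule hull_subset)

lemma field_adjoin_least: "is_subfield L \<Longrightarrow> F \<subseteq> L \<Longrightarrow> S \<subseteq> L \<Longrightarrow> field_adjoin F S \<subseteq> L"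
  unfolding field_adjoin_def by (rule hull_minimal) auto

lemma field_adjoin_mono: "F \<subseteq> F' \<Longrightarrow> S \<subseteq> S' \<Longrightarrow> field_adjoin F S \<subseteq> field_adjoin F' S'"
  unfolding field_adjoin_def by (rule hull_mono) auto

lemma field_adjoin_adjoin: "field_adjoin (field_adjoin F S) T = field_adjoin F (S \<union> T)"
proof
  show "field_adjoin (field_adjoin F S) T \<subseteq> field_adjoin F (S \<union> T)"
    using field_adjoin_superset[of F "S \<union> T"]
    by (intro field_adjoin_least is_subfield_field_adjoin field_adjoin_mono) auto
  show "field_adjoin F (S \<union> T) \<subseteq> field_adjoin (field_adjoin F S) T"
    using field_adjoin_superset[of F S] field_adjoin_superset[of "field_adjoin F S" T]
    by (intro field_adjoin_least is_subfield_field_adjoin) auto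
qed

lemma field_adjoin_absorb: "is_subfield F \<Longrightarrow> S \<subseteq> F \<Longrightarrow> field_adjoin F S = F"
  by (simp add: field_adjoin_def hull_same Un_absorb2)

text \<open>
  The quotients of values of polynomials at \<open>z\<close> form a subfield, so they exhaust the simple extension.
\<close>

lemma field_adjoin_singleE:
  assumes K: "is_subfield K" and u: "u \<in> field_adjoin K {z}"
  obtains p q where "p \<in> polys_over K" "q \<in> polys_over K" "poly q z \<noteq> 0" "u = poly p z / poly q z"
proof -
  define L where "L = {poly p z / poly q z | p q. p \<in> polys_over K \<and> q \<in> polys_over K \<and> poly q z \<noteq> 0}"
  have LI: "poly p z / poly q z \<in> L" if "p \<in> polys_over K" "q \<in> polys_over K" "poly q z \<noteq> 0" for p q
    using that unfolding L_def by blast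
  have 1: "c \<in> L" if "c \<in> K" for c
    using LI[of "[:c:]" 1] that by (simp add: polys_over_1[OF K] polys_over_pCons_iff[OF K] polys_over_0[OF K])
  have "is_subfield L"
    unfolding is_subfield_def
  proof (intro conjI ballI impI)
    fix x y assume "x \<in> L" "y \<in> L"
    then obtain p q p' q' where *: "p \<in> polys_over K" "q \<in> polys_over K" "poly q z \<noteq> 0"
      "p' \<in> polys_over K" "q' \<in> polys_over K" "poly q' z \<noteq> 0"
      "x = poly p z / poly q z" "y = poly p' z / poly q' z" unfolding L_def by blast
    have "x + y = poly (p * q' + p' * q) z / poly (q * q') z" "x * y = poly (p * p') z / poly (q * q') z"
      using *(3,6) unfolding *(7,8) by (simp_all add: add_frac_eq mult_ac)
    moreover have "poly (q * q') z \<noteq> 0" using * by simp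
    ultimately show "x + y \<in> L" "x * y \<in> L"
      using * by (auto intro!: LI polys_over_mult[OF K] polys_over_add[OF K] simp del: poly_mult poly_add)
  next
    fix x assume "x \<in> L"
    then obtain p q where *: "p \<in> polys_over K" "q \<in> polys_over K" "poly q z \<noteq> 0"
      "x = poly p z / poly q z" unfolding L_def by blast
    then show "- x \<in> L" using LI[of "-p" q] by (simp add: polys_over_uminus[OF K])
    show "inverse x \<in> L" if "x \<noteq> 0" using that * LI[of q p] by simp
  qed (auto intro: 1 subfieldD[OF K])
  moreover have "K \<subseteq> L" using 1 by blast
  moreover have "z \<in> L"
    using LI[of "[:0,1:]" 1] by (simp add: polys_over_1[OF K] polys_over_pCons_iff[OF K] polys_over_0[OF K] subfieldD[OF K])
  ultimately have "u \<in> L" using u field_adjoin_least[of L K "{z}"] by blast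
  then show ?thesis using that unfolding L_def by blast
qed

lemma poly_in_field_adjoin:
  assumes "p \<in> polys_over K"
  shows "poly p z \<in> field_adjoin K {z}"
proof -
  have "K \<subseteq> field_adjoin K {z}" "z \<in> field_adjoin K {z}" using field_adjoin_superset[of K "{z}"] by auto
  then show ?thesis
    using polys_over_poly[OF is_subfield_field_adjoin] polys_over_mono assms by blast
qed

definition transcendental_over :: "'a::field set \<Rightarrow> 'a \<Rightarrow> bool" where
  "transcendental_over K z \<longleftrightarrow> (\<forall>p\<in>polys_over K. poly p z = 0 \<longrightarrow> p = 0)"

lemma transcendental_over_eqD:
  "is_subfield K \<Longrightarrow> transcendental_over K z \<Longrightarrow> p \<in> polys_over K \<Longrightarrow> q \<in> polys_over K \<Longrightarrow>
    poly p z = poly q z \<Longrightarrow> p = q"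
  unfolding transcendental_over_def using polys_over_diff[of K p q] by force

text \<open>
  If \<open>x \<in> K\<close> equals \<open>p(z) / q(z)\<close>, then \<open>x q - p\<close> is a polynomial over \<open>K\<close> vanishing at \<open>z\<close>, so
  \<open>x q = p\<close>, and comparing leading coefficients expresses \<open>x\<close> as a quotient of elements of \<open>M\<close>.
\<close>

lemma adjoin_transcendental_Int:
  assumes K: "is_subfield K" and M: "is_subfield M" and MK: "M \<subseteq> K"
    and tr: "transcendental_over K z" and x: "x \<in> K" "x \<in> field_adjoin M {z}"
  shows "x \<in> M"
proof -
  obtain p q where *: "p \<in> polys_over M" "q \<in> polys_over M" "poly q z \<noteq> 0" "x = poly p z / poly q z"
    using field_adjoin_singleE[OF M x(2)] by blast
  have "poly (smult x q) z = poly p z" using * by simp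
  moreover have "smult x q \<in> polys_over K" "p \<in> polys_over K"
    using * x polys_over_mono[OF MK] by (auto intro: polys_over_smult[OF K])
  ultimately have "smult x q = p" using transcendental_over_eqD[OF K tr] by blast
  then have "x * lead_coeff q = coeff p (degree q)" by auto
  moreover have "lead_coeff q \<noteq> 0" using * by auto
  ultimately have "x = coeff p (degree q) / lead_coeff q" by (simp add: field_simps)
  then show ?thesis using * subfieldD(8)[OF M] by (auto simp: polys_over_def)
qed

section \<open>Rational functions with polynomial parts over a smaller field\<close>

text \<open>
  Gaussian elimination over \<open>M\<close>, valid for infinitely many equations: an equation in which the last
  unknown occurs is used to eliminate that unknown from all the others; if there is none, the last
  unit vector is a solution.
\<close>

lemma homogeneous_system_descent:
  fixes S :: "(nat \<Rightarrow> 'a::field) set"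
  assumes M: "is_subfield M" and "\<And>s i. s \<in> S \<Longrightarrow> s i \<in> M"
    and "\<And>s. s \<in> S \<Longrightarrow> (\<Sum>i<m. y i * s i) = 0" and "\<exists>i<m. y i \<noteq> 0"
  shows "\<exists>x. (\<forall>i. x i \<in> M) \<and> (\<exists>i<m. x i \<noteq> 0) \<and> (\<forall>s\<in>S. (\<Sum>i<m. x i * s i) = 0)"
  using assms(2-)
proof (induction m arbitrary: S)
  case (Suc m)
  show ?case
  proof (cases "\<forall>s\<in>S. s m = 0")
    case True
    let ?x = "\<lambda>i. if i = m then 1 else (0::'a)"
    have "(\<Sum>i<Suc m. ?x i * s i) = 0" if "s \<in> S" for s using that True by simp
    then show ?thesis
      by (intro exI[of _ ?x]) (auto simp: subfieldD[OF M])
  next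
    case False
    then obtain p where p: "p \<in> S" "p m \<noteq> 0" by blast
    define T where "T = (\<lambda>s i. s i - s m / p m * p i) ` S"
    have py: "y m = - (\<Sum>i<m. y i * p i) / p m"
      using Suc.prems(2)[OF p(1)] unfolding nonzero_eq_divide_eq[OF p(2)]
      by (simp add: eq_neg_iff_add_eq_0 add.commute)
    have elim: "(\<Sum>i<Suc m. x i * s i) = (\<Sum>i<m. x i * (s i - s m / p m * p i))"
      if "x m = - (\<Sum>i<m. x i * p i) / p m" for x s
      using that by (simp add: algebra_simps sum_subtractf sum_distrib_left sum_divide_distrib)
    \<comment> \<open>The pivot equation determines the last unknown, so a nontrivial solution stays nontrivial
      after elimination.\<close>
    have "\<exists>i<m. y i \<noteq> 0"
    proof (rule ccontr)
      assume no: "\<not> (\<exists>i<m. y i \<noteq> 0)"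
      then have "y m = 0" using py by simp
      with no Suc.prems(3) show False by (metis less_Suc_eq)
    qed
    moreover have "t i \<in> M" if "t \<in> T" for t i
      using that p Suc.prems(1) unfolding T_def by (auto intro!: subfieldD[OF M])
    moreover have "(\<Sum>i<m. y i * t i) = 0" if "t \<in> T" for t
      using that elim[OF py] Suc.prems(2) unfolding T_def by (auto simp del: sum.lessThan_Suc)
    ultimately obtain x where x: "\<And>i. x i \<in> M" "\<exists>i<m. x i \<noteq> 0" "\<forall>t\<in>T. (\<Sum>i<m. x i * t i) = 0"
      using Suc.IH[of T] by blast
    define x' where "x' = x(m := - (\<Sum>i<m. x i * p i) / p m)"
    have x'm: "x' m = - (\<Sum>i<m. x' i * p i) / p m" by (simp add: x'_def)
    have "(\<Sum>i<Suc m. x' i * s i) = 0" if "s \<in> S" for s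
    proof -
      have "(\<Sum>i<m. x i * (s i - s m / p m * p i)) = 0" using x(3) that by (simp add: T_def)
      moreover have "(\<Sum>i<m. x' i * (s i - s m / p m * p i)) = (\<Sum>i<m. x i * (s i - s m / p m * p i))"
        by (simp add: x'_def)
      ultimately show ?thesis unfolding elim[OF x'm] by simp
    qed
    moreover have "x' i \<in> M" for i
      using x(1) p Suc.prems(1) unfolding x'_def
      by (auto intro!: subfieldD[OF M] subfield_sum[OF M])
    moreover have "\<exists>i<Suc m. x' i \<noteq> 0" using x(2) by (auto simp: x'_def intro: less_SucI)
    ultimately show ?thesis by blast
  qed
qed auto

lemma poly_div_sum_left: "(\<Sum>i\<in>A. f i) div q = (\<Sum>i\<in>A. f i div (q :: 'a::field poly))"
  by (induction A rule: infinite_finite_induct) (auto simp: poly_div_add_left)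

text \<open>
  The number \<open>coeff ((x\<^sup>n A) div Q) 0\<close> is the coefficient of \<open>x\<^bsup>-n\<^esup>\<close> in the expansion of \<open>A / Q\<close> at
  infinity.  A nonzero remainder \<open>R\<close> would contribute its leading term at \<open>n = degree Q - degree R\<close>.
\<close>

lemma dvd_if_residues_vanish:
  fixes A Q :: "'a::field poly"
  assumes "Q \<noteq> 0" and "\<And>n. n \<ge> 1 \<Longrightarrow> coeff ((monom 1 n * A) div Q) 0 = 0"
  shows "Q dvd A"
proof (rule ccontr)
  define R where "R = A mod Q"
  assume "\<not> Q dvd A"
  then have R: "R \<noteq> 0" by (simp add: R_def mod_eq_0_iff_dvd)
  have dR: "degree R < degree Q" using degree_mod_less[OF assms(1), of A] R by (simp add: R_def)
  define n where "n = degree Q - degree R"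
  define c where "c = lead_coeff R / lead_coeff Q"
  have "monom 1 n * A = monom 1 n * R + (monom 1 n * (A div Q)) * Q"
    by (simp add: R_def mult.assoc distrib_left[symmetric])
  then have e1: "(monom 1 n * A) div Q = (monom 1 n * R) div Q + monom 1 n * (A div Q)"
    using assms(1) by (simp add: poly_div_add_left)
  have "degree (monom (1::'a) n) = n" by (intro degree_monom_eq) simp
  then have dn: "degree (monom 1 n * R) = degree Q"
    using R dR by (simp add: degree_mult_eq n_def)
  have ln: "lead_coeff (monom 1 n * R) = lead_coeff R"
    by (simp only: lead_coeff_mult lead_coeff_monom mult_1)
  define r where "r = monom 1 n * R - smult c Q"
  have "degree r \<le> degree Q"
    unfolding r_def using dn by (intro degree_diff_le) simp_all
  moreover have "coeff r (degree Q) = 0"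
    using ln assms(1) unfolding dn by (simp add: r_def c_def)
  ultimately have "r = 0 \<or> degree r < degree Q"
    by (metis le_neq_implies_less leading_coeff_0_iff)
  then have "r div Q = 0" by (auto simp: div_poly_less)
  moreover have "monom 1 n * R = r + [:c:] * Q" by (simp add: r_def)
  moreover have "([:c:] * Q) div Q = [:c:]"
    using assms(1) by (rule nonzero_mult_div_cancel_right)
  ultimately have "(monom 1 n * R) div Q = [:c:]"
    by (simp only: poly_div_add_left add_0)
  with e1 have "coeff ((monom 1 n * A) div Q) 0 = c"
    using dR by (simp add: coeff_monom_mult n_def)
  moreover have "c \<noteq> 0" using R assms(1) by (simp add: c_def)
  moreover have "n \<ge> 1" using dR by (simp add: n_def)
  ultimately show False using assms(2) by blast
qed

text \<open>
  A polynomial \<open>q\<close> of degree at most \<open>degree Q\<close> is a denominator of \<open>P / Q\<close> if and only if the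
  coefficients of all the negative powers in the expansion of \<open>q P / Q\<close> vanish.  These are linear
  equations for the coefficients of \<open>q\<close>; they have coefficients in \<open>M\<close> and the nontrivial
  solution \<open>Q\<close>, so they also have a nontrivial solution over \<open>M\<close>.
\<close>

lemma rational_descent:
  fixes P Q :: "'a::field poly"
  assumes M: "is_subfield M" and Q: "Q \<noteq> 0"
    and parts: "\<And>k. (monom 1 k * P) div Q \<in> polys_over M"
  obtains p q where "p \<in> polys_over M" "q \<in> polys_over M" "q \<noteq> 0" "q * P = p * Q"
proof -
  let ?m = "Suc (degree Q)"
  define c where "c n i = coeff ((monom 1 (n + i) * P) div Q) 0" for n i :: nat
  define S where "S = c ` {1..}"
  define pol where "pol x = (\<Sum>i<?m. monom (x i) i)" for x :: "nat \<Rightarrow> 'a"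
  have split: "(monom 1 n * (pol x * P)) div Q = (\<Sum>i<?m. smult (x i) ((monom 1 (n + i) * P) div Q))" for n x
  proof -
    have "monom 1 n * (pol x * P) = (\<Sum>i<?m. smult (x i) (monom 1 (n + i) * P))"
      unfolding pol_def sum_distrib_right sum_distrib_left
      by (intro sum.cong refl) (simp add: mult.assoc[symmetric] mult_monom smult_monom flip: mult_smult_left)
    then show ?thesis by (simp only: poly_div_sum_left div_smult_left)
  qed
  have key: "coeff ((monom 1 n * (pol x * P)) div Q) 0 = (\<Sum>i<?m. x i * c n i)" for n x
    unfolding split by (simp add: coeff_sum c_def)
  have "\<exists>x. (\<forall>i. x i \<in> M) \<and> (\<exists>i<?m. x i \<noteq> 0) \<and> (\<forall>s\<in>S. (\<Sum>i<?m. x i * s i) = 0)"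
  proof (rule homogeneous_system_descent[OF M])
    show "s i \<in> M" if "s \<in> S" for s i
      using that parts by (auto simp: S_def c_def polys_over_def)
    show "\<exists>i<?m. coeff Q i \<noteq> 0" using Q by (intro exI[of _ "degree Q"]) simp
    fix s assume "s \<in> S"
    then obtain n where n: "n \<ge> 1" "s = c n" by (auto simp: S_def)
    have "pol (coeff Q) = Q" by (simp add: pol_def poly_as_sum_of_monoms lessThan_Suc_atMost)
    then have "(\<Sum>i<?m. coeff Q i * c n i) = coeff ((monom 1 n * P * Q) div Q) 0"
      unfolding key[symmetric] by (simp add: mult_ac)
    also have "\<dots> = 0" using Q n by (simp add: coeff_monom_mult)
    finally show "(\<Sum>i<?m. coeff Q i * s i) = 0" using n by simp
  qed
  then obtain x where x: "\<And>i. x i \<in> M" "\<exists>i<?m. x i \<noteq> 0" "\<forall>s\<in>S. (\<Sum>i<?m. x i * s i) = 0" by blast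
  have "Q dvd pol x * P"
    using x(3) by (intro dvd_if_residues_vanish[OF Q]) (simp add: key S_def del: sum.lessThan_Suc)
  then have "pol x * P = (pol x * P) div Q * Q" by simp
  moreover have "(pol x * P) div Q \<in> polys_over M"
    using split[of 0 x] parts x(1) by (auto intro!: polys_over_sum[OF M] polys_over_smult[OF M] simp: one_pCons[symmetric] simp del: sum.lessThan_Suc)
  moreover have "pol x \<in> polys_over M"
    unfolding pol_def using x(1) by (intro polys_over_sum[OF M] polys_over_monom[OF M])
  moreover have "pol x \<noteq> 0"
  proof -
    obtain j where "j < ?m" "x j \<noteq> 0" using x(2) by blast
    then have "coeff (pol x) j \<noteq> 0"
      unfolding pol_def coeff_sum coeff_monom by (simp add: sum.delta del: sum.lessThan_Suc)
    then show ?thesis by auto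
  qed
  ultimately show ?thesis using that by blast
qed

section \<open>Differentiating polynomial expressions\<close>

text \<open>
  With \<open>a\<close> the derivative of \<open>z\<close>, this is the chain rule for \<open>p(z)\<close>; see \<open>D_poly\<close> below.
\<close>

definition total_deriv :: "('a::field \<Rightarrow> 'a) \<Rightarrow> 'a \<Rightarrow> 'a poly \<Rightarrow> 'a poly" where
  "total_deriv D a p = map_poly D p + smult a (pderiv p)"

context
  fixes D :: "'a::field_char_0 \<Rightarrow> 'a" and E :: "'a set"
  assumes E: "differential_field D E"
begin

lemma subfield_E: "is_subfield E"
  using E by (simp add: differential_field_def)

lemma D_add: "x \<in> E \<Longrightarrow> y \<in> E \<Longrightarrow> D (x + y) = D x + D y"
  using E by (simp add: differential_field_def)

lemma D_mult: "x \<in> E \<Longrightarrow> y \<in> E \<Longrightarrow> D (x * y) = D x * y + x * D y"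
  using E by (simp add: differential_field_def)

lemma D_0: "D 0 = 0"
  using D_add[of 0 0] subfieldD[OF subfield_E] by simp

lemma D_1: "D 1 = 0"
  using D_mult[of 1 1] subfieldD[OF subfield_E] by simp

lemma D_minus: "x \<in> E \<Longrightarrow> D (- x) = - D x"
  using D_add[of x "-x"] D_0 subfieldD[OF subfield_E] by (simp add: eq_neg_iff_add_eq_0 add.commute)

lemma D_diff: "x \<in> E \<Longrightarrow> y \<in> E \<Longrightarrow> D (x - y) = D x - D y"
  using D_add[of x "-y"] D_minus subfieldD[OF subfield_E] by simp

lemma D_of_nat_mult: "x \<in> E \<Longrightarrow> D (of_nat n * x) = of_nat n * D x"
  using subfield_of_nat[OF subfield_E] subfieldD[OF subfield_E]
  by (induction n) (simp_all add: D_0 D_add distrib_right)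

lemma D_power: "x \<in> E \<Longrightarrow> D (x ^ Suc n) = of_nat (Suc n) * x ^ n * D x"
proof (induction n)
  case (Suc n)
  have "D (x ^ Suc (Suc n)) = D x * x ^ Suc n + x * D (x ^ Suc n)"
    unfolding power_Suc[of x "Suc n"] using Suc.prems subfield_power[OF subfield_E] by (intro D_mult)
  with Suc show ?case by (simp add: algebra_simps)
qed simp

lemma coeff_total_deriv: "coeff (total_deriv D a p) n = D (coeff p n) + a * (of_nat (Suc n) * coeff p (Suc n))"
  by (simp add: total_deriv_def coeff_map_poly D_0 coeff_pderiv)

lemma degree_total_deriv_le: "degree (total_deriv D a p) \<le> degree p"
  by (rule degree_le) (simp add: coeff_total_deriv coeff_eq_0 D_0)

lemma total_deriv_polys_over:
  assumes "is_subfield K" "\<And>x. x \<in> K \<Longrightarrow> D x \<in> K" "a \<in> K" "p \<in> polys_over K"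
  shows "total_deriv D a p \<in> polys_over K"
  using assms unfolding polys_over_def
  by (auto simp: coeff_total_deriv simp del: of_nat_Suc intro!: subfieldD[OF assms(1)] subfield_of_nat)

lemma D_poly:
  assumes z: "z \<in> E" and p: "p \<in> polys_over E"
  shows "D (poly p z) = poly (total_deriv D (D z) p) z"
  using p
proof (induction p)
  case (pCons c p)
  then have c: "c \<in> E" "p \<in> polys_over E" by (auto simp: polys_over_pCons_iff[OF subfield_E])
  have "poly p z \<in> E" using polys_over_poly[OF subfield_E c(2) z] .
  then have "D (poly (pCons c p) z) = D c + (D z * poly p z + z * D (poly p z))"
    using c z subfieldD[OF subfield_E] by (simp add: D_add D_mult)
  also have "D (poly p z) = poly (total_deriv D (D z) p) z"
    using pCons.IH c by blast
  finally show ?case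
    by (simp add: total_deriv_def map_poly_pCons D_0 pderiv_pCons algebra_simps)
qed (simp add: D_0 total_deriv_def)

text \<open>
  By the quotient rule it suffices that the derivatives of polynomial values stay in the extension.
\<close>

lemma field_adjoin_D_closed:
  assumes F: "is_subfield F" "F \<subseteq> E" "\<And>x. x \<in> F \<Longrightarrow> D x \<in> F"
    and z: "z \<in> E" "D z \<in> field_adjoin F {z}" and x: "x \<in> field_adjoin F {z}"
  shows "D x \<in> field_adjoin F {z}"
proof -
  let ?L = "field_adjoin F {z}"
  have L: "is_subfield ?L" by (rule is_subfield_field_adjoin)
  have FL: "F \<subseteq> ?L" "z \<in> ?L" using field_adjoin_superset[of F "{z}"] by auto
  obtain p q where pq: "p \<in> polys_over F" "q \<in> polys_over F" "poly q z \<noteq> 0" "x = poly p z / poly q z"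
    using field_adjoin_singleE[OF F(1) x] by blast
  have pE: "r \<in> polys_over E" if "r \<in> polys_over F" for r using that polys_over_mono[OF F(2)] by blast
  have DL: "D (poly r z) \<in> ?L" if r: "r \<in> polys_over F" for r
  proof -
    have "map_poly D r \<in> polys_over F"
      using r F(3) by (simp add: polys_over_def coeff_map_poly D_0)
    moreover have "pderiv r \<in> polys_over F"
      using r F(1) by (auto simp: polys_over_def coeff_pderiv simp del: of_nat_Suc intro!: subfieldD subfield_of_nat)
    ultimately show ?thesis
      unfolding D_poly[OF z(1) pE[OF r]] total_deriv_def poly_add poly_smult
      using z(2) by (intro subfieldD[OF L] poly_in_field_adjoin)
  qed
  have E': "poly q z \<in> E" "x \<in> E"
    using pq pE polys_over_poly[OF subfield_E] z(1) subfieldD(8)[OF subfield_E] by auto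
  have "D (poly p z) = D x * poly q z + x * D (poly q z)"
    using D_mult[OF E'(2,1)] pq by simp
  then have "D x = (D (poly p z) - x * D (poly q z)) / poly q z"
    using pq(3) by (simp add: field_simps)
  then show ?thesis
    using DL[OF pq(1)] DL[OF pq(2)] x poly_in_field_adjoin[OF pq(2), of z]
    by (auto intro!: subfieldD[OF L])
qed

section \<open>Antiderivatives over a field with the same constants\<close>

text \<open>
  Let \<open>r = x\<^sup>n + c x\<^bsup>n-1\<^esup> + \<dots>\<close> be a minimal polynomial of \<open>z\<close>.  Differentiating \<open>r(z) = 0\<close> gives a
  relation for \<open>z\<close> of degree less than \<open>n\<close>, because \<open>r\<close> is monic, so this relation is trivial.  Its
  coefficient \<open>c' + n z'\<close> of \<open>x\<^bsup>n-1\<^esup>\<close> is the derivative of \<open>c + n z\<close>, which is thus a constant.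
  In characteristic zero, \<open>z \<in> K\<close> follows.
\<close>

lemma antiderivative_transcendental:
  assumes K: "is_subfield K" "K \<subseteq> E" "\<And>x. x \<in> K \<Longrightarrow> D x \<in> K"
    and C: "constants D E \<subseteq> K" and z: "z \<in> E" "z \<notin> K" "D z \<in> K"
  shows "transcendental_over K z"
proof (rule ccontr)
  assume "\<not> ?thesis"
  then have ex: "\<exists>p. p \<in> polys_over K \<and> p \<noteq> 0 \<and> poly p z = 0" by (auto simp: transcendental_over_def)
  define p where "p = arg_min degree (\<lambda>p. p \<in> polys_over K \<and> p \<noteq> 0 \<and> poly p z = 0)"
  have p: "p \<in> polys_over K" "p \<noteq> 0" "poly p z = 0"
    and least: "\<And>q. q \<in> polys_over K \<Longrightarrow> poly q z = 0 \<Longrightarrow> degree q < degree p \<Longrightarrow> q = 0"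
    using arg_min_nat_lemma[of "\<lambda>p. p \<in> polys_over K \<and> p \<noteq> 0 \<and> poly p z = 0" _ degree] ex
    unfolding p_def by (blast, blast, blast, meson leD)
  define n where "n = degree p"
  define r where "r = smult (inverse (lead_coeff p)) p"
  have r: "r \<in> polys_over K" "poly r z = 0" "degree r = n" "coeff r n = 1"
    using p by (auto simp: r_def n_def polys_over_def intro!: subfieldD[OF K(1)])
  have n: "n > 0"
  proof (rule ccontr)
    assume "\<not> n > 0"
    then obtain c where "p = [:c:]" unfolding n_def using degree_0_id[of p] by (metis gr0I)
    with p show False by simp
  qed
  let ?d = "total_deriv D (D z) r"
  have "?d \<in> polys_over K" by (intro total_deriv_polys_over K z r)
  moreover have "poly ?d z = 0"
    using D_poly[OF z(1), of r] r polys_over_mono[OF K(2)] D_0 by auto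
  moreover have "degree ?d < n"
  proof -
    have "coeff ?d n = 0" by (simp add: coeff_total_deriv r coeff_eq_0 D_1)
    then show ?thesis
      using degree_total_deriv_le[of "D z" r] r(3) n
      by (metis degree_0 le_neq_implies_less leading_coeff_0_iff)
  qed
  ultimately have "?d = 0" using least unfolding n_def by blast
  then have "coeff ?d (n - 1) = 0" by simp
  then have *: "D (coeff r (n - 1)) + of_nat n * D z = 0"
    using n r(4) by (simp add: coeff_total_deriv mult.commute del: of_nat_Suc)
  have c: "coeff r (n - 1) \<in> K" using r by (auto simp: polys_over_def)
  let ?s = "coeff r (n - 1) + of_nat n * z"
  have "?s \<in> constants D E"
    using * c K(2) z subfield_of_nat[OF subfield_E] subfieldD[OF subfield_E]
    by (auto simp: constants_def D_add D_of_nat_mult)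
  then have "?s \<in> K" using C by blast
  then have "?s - coeff r (n - 1) \<in> K" using c by (rule subfieldD(6)[OF K(1)])
  then have "(?s - coeff r (n - 1)) / of_nat n \<in> K"
    using subfield_of_nat[OF K(1)] by (rule subfieldD(8)[OF K(1)])
  with n z show False by simp
qed

text \<open>
  The condition \<open>r div Q = 0\<close> expresses that \<open>r / Q\<close> is a proper fraction in a form that is visibly
  additive in \<open>r\<close>.
\<close>

lemma proper_mult:
  fixes r Q c C :: "'a poly"
  assumes "r div Q = 0" "degree c \<le> degree C" "Q \<noteq> 0" "C \<noteq> 0"
  shows "(r * c) div (Q * C) = 0"
proof (cases "r = 0 \<or> c = 0")
  case False
  then show ?thesis using assms by (auto simp: div_poly_eq_0_iff degree_mult_eq)
qed auto

text \<open>
  Write \<open>v = q(z) + r(z) / Q(z)\<close> with \<open>q\<close> the polynomial part.  The derivative of a proper fraction is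
  proper, because differentiation does not raise the degree in \<open>z\<close>.  Hence the polynomial part
  of \<open>v'\<close>, which is \<open>h\<close>, is the derivative of \<open>q\<close>, and the closedness of \<open>M\<close> yields the coefficients of
  \<open>q\<close>, the highest one first.
\<close>

lemma polynomial_part_descent:
  assumes K: "is_subfield K" "K \<subseteq> E" "\<And>x. x \<in> K \<Longrightarrow> D x \<in> K"
    and M: "is_subfield M" "M \<subseteq> K"
    and closed: "\<And>b. b \<in> K \<Longrightarrow> D b \<in> M \<Longrightarrow> b \<in> M"
    and z: "z \<in> E" "D z \<in> M" "transcendental_over K z"
    and N: "N \<in> polys_over K" "Q \<in> polys_over K" "Q \<noteq> 0"
    and B: "h \<in> polys_over M" "t \<in> polys_over K" "B \<in> polys_over K" "B \<noteq> 0" "t div B = 0"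
    and v: "v * poly Q z = poly N z" "v \<in> E" "D v * poly B z = poly h z * poly B z + poly t z"
  shows "N div Q \<in> polys_over M"
proof -
  let ?\<delta> = "total_deriv D (D z)"
  define q where "q = N div Q"
  define r where "r = N mod Q"
  have q: "q \<in> polys_over K" "r \<in> polys_over K"
    unfolding q_def r_def using polys_over_div polys_over_mod K(1) N by blast+
  have pE: "p \<in> polys_over E" if "p \<in> polys_over K" for p using that polys_over_mono[OF K(2)] by blast
  have d: "?\<delta> p \<in> polys_over K" if "p \<in> polys_over K" for p
    using that z M by (intro total_deriv_polys_over[OF K(1,3)]) auto
  have hK: "h \<in> polys_over K" using B polys_over_mono[OF M(2)] by blast
  have val: "poly p z \<in> E" if "p \<in> polys_over K" for p
    using polys_over_poly[OF subfield_E pE[OF that] z(1)] .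
  have NQ: "N = q * Q + r" by (simp add: q_def r_def)
  have w: "(v - poly q z) * poly Q z = poly r z"
    using v(1) by (simp add: NQ algebra_simps)
  have "D ((v - poly q z) * poly Q z) = (D v - D (poly q z)) * poly Q z + (v - poly q z) * D (poly Q z)"
    using v(2) val q N subfieldD[OF subfield_E] by (simp add: D_mult D_diff)
  then have w': "(D v - poly (?\<delta> q) z) * poly Q z + (v - poly q z) * poly (?\<delta> Q) z = poly (?\<delta> r) z"
    unfolding w using D_poly[OF z(1) pE] q N by simp
  \<comment> \<open>The numerator of \<open>(r / Q)' - t / B\<close> over the common denominator \<open>B Q\<^sup>2\<close>.\<close>
  define G where "G = ?\<delta> r * (Q * B) - r * (?\<delta> Q * B) - t * (Q * Q)"
  have "poly ((h - ?\<delta> q) * (B * (Q * Q))) z = poly G z"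
  proof -
    define x y where "x = D v" and "y = v - poly q z"
    have "poly (?\<delta> r) z * poly Q z * poly B z
      = (x - poly (?\<delta> q) z) * poly B z * (poly Q z * poly Q z) + (y * poly Q z) * poly (?\<delta> Q) z * poly B z"
      unfolding w'[symmetric] x_def y_def by (simp add: algebra_simps)
    moreover have "x * poly B z = poly h z * poly B z + poly t z" using v by (simp add: x_def)
    then have "(x - poly (?\<delta> q) z) * poly B z = (poly h z - poly (?\<delta> q) z) * poly B z + poly t z"
      by (simp add: algebra_simps)
    moreover have "y * poly Q z = poly r z" using w by (simp add: y_def)
    ultimately have "poly (?\<delta> r) z * poly Q z * poly B z
      = ((poly h z - poly (?\<delta> q) z) * poly B z + poly t z) * (poly Q z * poly Q z) + poly r z * poly (?\<delta> Q) z * poly B z"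
      by simp
    then show ?thesis by (simp add: G_def algebra_simps)
  qed
  then have eq: "(h - ?\<delta> q) * (B * (Q * Q)) = G"
    by (rule transcendental_over_eqD[OF K(1) z(3), rotated 2])
      (unfold G_def, (intro polys_over_mult[OF K(1)] polys_over_diff[OF K(1)] d q N B hK)+)
  \<comment> \<open>Each of the three terms of \<open>G\<close> is proper with respect to \<open>B Q\<^sup>2\<close>, so the polynomial factor on the
    left vanishes.\<close>
  have rQ: "r div Q = 0" by (simp add: r_def)
  have "?\<delta> r div Q = 0"
  proof (cases "r = 0")
    case True
    then show ?thesis by (simp add: total_deriv_def)
  next
    case False
    then have "degree r < degree Q" using rQ N by (simp add: div_poly_eq_0_iff)
    then show ?thesis using degree_total_deriv_le[of "D z" r] by (simp add: div_poly_less)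
  qed
  then have 1: "(?\<delta> r * (Q * B)) div (Q * (Q * B)) = 0" using N B by (intro proper_mult) auto
  have "degree (?\<delta> Q * B) \<le> degree (Q * B)"
    using degree_mult_le[of "?\<delta> Q" B] degree_total_deriv_le[of "D z" Q] N B by (simp add: degree_mult_eq)
  then have 2: "(r * (?\<delta> Q * B)) div (Q * (Q * B)) = 0" using N B rQ by (intro proper_mult) auto
  have 3: "(t * (Q * Q)) div (B * (Q * Q)) = 0" using N B by (intro proper_mult) auto
  have "h - ?\<delta> q = ((h - ?\<delta> q) * (B * (Q * Q))) div (B * (Q * Q))" using N B by simp
  also have "\<dots> = 0"
    unfolding eq G_def poly_div_diff_left using 1 2 3 by (simp add: mult_ac)
  finally have hq: "?\<delta> q = h" by simp
  \<comment> \<open>Downward induction on \<open>i\<close>, starting above the degree of \<open>q\<close>.\<close>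
  have "coeff q i \<in> M" for i
  proof (induction "Suc (degree q) - i" arbitrary: i)
    case 0
    then show ?case by (simp add: coeff_eq_0 subfieldD[OF M(1)])
  next
    case (Suc k)
    then have IH: "coeff q (Suc i) \<in> M" by simp
    have "D (coeff q i) = coeff h i - D z * (of_nat (Suc i) * coeff q (Suc i))"
      unfolding hq[symmetric] coeff_total_deriv by simp
    also have "\<dots> \<in> M"
      using IH z(2) B(1) by (intro subfieldD[OF M(1)] subfield_of_nat[OF M(1)]) (auto simp: polys_over_def)
    finally show ?case using closed q by (auto simp: polys_over_def)
  qed
  then show ?thesis by (simp add: q_def[symmetric] polys_over_def)
qed

text \<open>
  By \<open>rational_descent\<close> it suffices that the polynomial parts of all \<open>z\<^sup>k u\<close> have coefficients
  in \<open>M\<close>.  This follows by induction on \<open>k\<close> from \<open>polynomial_part_descent\<close>: the derivative of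
  \<open>z\<^bsup>k+1\<^esup> u\<close> is \<open>(k + 1) z' z\<^sup>k u + z\<^bsup>k+1\<^esup> u'\<close>; the polynomial part of the first summand is
  covered by the induction hypothesis, and the second summand is in \<open>M(z)\<close>.
\<close>

lemma antiderivative_closed_adjoin:
  assumes K: "is_subfield K" "K \<subseteq> E" "\<And>x. x \<in> K \<Longrightarrow> D x \<in> K"
    and M: "is_subfield M" "M \<subseteq> K"
    and closed: "\<And>b. b \<in> K \<Longrightarrow> D b \<in> M \<Longrightarrow> b \<in> M"
    and z: "z \<in> E" "D z \<in> M" "transcendental_over K z"
    and u: "u \<in> field_adjoin K {z}" "D u \<in> field_adjoin M {z}"
  shows "u \<in> field_adjoin M {z}"
proof -
  obtain P Q where PQ: "P \<in> polys_over K" "Q \<in> polys_over K" "poly Q z \<noteq> 0" "u = poly P z / poly Q z"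
    using field_adjoin_singleE[OF K(1) u(1)] by blast
  obtain R S where RS: "R \<in> polys_over M" "S \<in> polys_over M" "poly S z \<noteq> 0" "D u = poly R z / poly S z"
    using field_adjoin_singleE[OF M(1) u(2)] by blast
  have Q0: "Q \<noteq> 0" "S \<noteq> 0" using PQ RS by auto
  have MKp: "p \<in> polys_over K" if "p \<in> polys_over M" for p using that polys_over_mono[OF M(2)] by blast
  have uE: "u \<in> E"
    using u(1) field_adjoin_least[OF subfield_E K(2), of "{z}"] z by auto
  have zk: "z ^ k * u \<in> E" for k
    using uE z subfield_power[OF subfield_E] subfieldD[OF subfield_E] by blast
  note descent = polynomial_part_descent[OF K M closed z]
  let ?X = "\<lambda>k. monom (1::'a) k"
  have X: "?X k \<in> polys_over L" if "is_subfield L" for k L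
    using that by (intro polys_over_monom subfieldD)
  have part: "(?X k * P) div Q \<in> polys_over M" for k
  proof (induction k)
    case 0
    show ?case
    proof (rule descent[where v = u and h = "R div S" and t = "R mod S" and B = S])
      have "poly R z = poly (R div S * S + R mod S) z" by simp
      then have "poly R z = poly (R div S) z * poly S z + poly (R mod S) z"
        by (simp only: poly_add poly_mult)
      then show "D u * poly S z = poly (R div S) z * poly S z + poly (R mod S) z"
        using RS by simp
    qed (use PQ RS Q0 uE MKp in \<open>auto intro!: polys_over_div polys_over_mod K M simp: one_pCons[symmetric]\<close>)
  next
    case (Suc k)
    define q r where "q = (?X k * P) div Q" and "r = (?X k * P) mod Q"
    define H T where "H = (?X (Suc k) * R) div S" and "T = (?X (Suc k) * R) mod S"
    define c where "c = of_nat (Suc k) * D z"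
    have c: "c \<in> M" unfolding c_def by (intro subfieldD[OF M(1)] subfield_of_nat[OF M(1)] z)
    have mem: "q \<in> polys_over M" "r \<in> polys_over K" "H \<in> polys_over M" "T \<in> polys_over K"
      using Suc PQ RS MKp X[OF K(1)] X[OF M(1)] unfolding q_def r_def H_def T_def
      by (auto intro!: polys_over_mod[OF K(1)] polys_over_mult[OF K(1)] polys_over_mult[OF M(1)] polys_over_div[OF M(1)])
    have "poly (?X k * P) z = poly (q * Q + r) z" by (simp add: q_def r_def)
    then have e1: "z ^ k * u * poly Q z = poly q z * poly Q z + poly r z"
      using PQ by (simp add: poly_monom)
    have "poly (?X (Suc k) * R) z = poly (H * S + T) z" by (simp add: H_def T_def)
    then have e2: "z ^ Suc k * D u * poly S z = poly H z * poly S z + poly T z"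
      using RS by (simp add: poly_monom)
    have Dv: "D (z ^ Suc k * u) = c * (z ^ k * u) + z ^ Suc k * D u"
      using z(1) uE subfield_power[OF subfield_E] by (simp add: D_mult D_power c_def mult_ac del: power_Suc of_nat_Suc)
    show ?case
    proof (rule descent[where v = "z ^ Suc k * u" and h = "smult c q + H"
            and t = "smult c (r * S) + T * Q" and B = "Q * S"])
      have "D (z ^ Suc k * u) * (poly Q z * poly S z)
          = c * (z ^ k * u * poly Q z) * poly S z + (z ^ Suc k * D u * poly S z) * poly Q z"
        unfolding Dv by (simp add: algebra_simps)
      also have "\<dots> = c * (poly q z * poly Q z + poly r z) * poly S z + (poly H z * poly S z + poly T z) * poly Q z"
        unfolding e1 e2 ..
      finally show "D (z ^ Suc k * u) * poly (Q * S) z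
          = poly (smult c q + H) z * poly (Q * S) z + poly (smult c (r * S) + T * Q) z"
        by (simp add: algebra_simps)
      have "(r * S) div (Q * S) = 0" "(T * Q) div (S * Q) = 0"
        using Q0 by (auto intro!: proper_mult simp: r_def T_def)
      then show "(smult c (r * S) + T * Q) div (Q * S) = 0"
        by (simp only: poly_div_add_left div_smult_left mult.commute[of S Q]) simp
      show "z ^ Suc k * u * poly Q z = poly (?X (Suc k) * P) z"
        using PQ by (simp add: poly_monom)
    qed (use PQ Q0 RS mem c M(2) zk[of "Suc k"] MKp X[OF K(1)] in
        \<open>auto intro!: polys_over_add[OF K(1)] polys_over_add[OF M(1)] polys_over_mult[OF K(1)] polys_over_smult[OF K(1)] polys_over_smult[OF M(1)] simp del: power_Suc\<close>)
  qed
  obtain p q where pq: "p \<in> polys_over M" "q \<in> polys_over M" "q \<noteq> 0" "q * P = p * Q"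
    using rational_descent[OF M(1) Q0(1) part] by blast
  have "poly q z \<noteq> 0" using pq MKp z(3) unfolding transcendental_over_def by blast
  moreover have "poly q z * poly P z = poly p z * poly Q z"
    using pq(4) by (simp flip: poly_mult)
  ultimately have "u = poly p z / poly q z" using PQ(3) by (simp add: PQ(4) frac_eq_eq mult_ac)
  then show ?thesis
    using pq poly_in_field_adjoin subfieldD(8)[OF is_subfield_field_adjoin] by blast
qed

end

section \<open>Towers of antiderivatives\<close>

text \<open>
  Unlike \<open>iterated_antiderivatives\<close>, this does not mention an ambient extension, so towers can be
  regarded over varying base fields.
\<close>

definition antiderivative_tower :: "('a::field \<Rightarrow> 'a) \<Rightarrow> 'a set \<Rightarrow> 'a list \<Rightarrow> bool" where
  "antiderivative_tower D F zs \<longleftrightarrow> (\<forall>i<length zs. D (zs ! i) \<in> field_adjoin F (set (take i zs)))"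

lemma antiderivative_tower_Nil: "antiderivative_tower D F []"
  by (simp add: antiderivative_tower_def)

lemma antiderivative_tower_snoc:
  "antiderivative_tower D F (zs @ [z]) \<longleftrightarrow> antiderivative_tower D F zs \<and> D z \<in> field_adjoin F (set zs)"
  by (auto simp: antiderivative_tower_def nth_append less_Suc_eq)

lemma antiderivative_tower_Cons:
  assumes "is_subfield F"
  shows "antiderivative_tower D F (z # zs) \<longleftrightarrow> D z \<in> F \<and> antiderivative_tower D (field_adjoin F {z}) zs"
  by (simp add: antiderivative_tower_def All_less_Suc2 field_adjoin_empty[OF assms] field_adjoin_adjoin)

lemma antiderivative_tower_append:
  assumes "antiderivative_tower D F xs" "antiderivative_tower D F ys"
  shows "antiderivative_tower D F (xs @ ys)"
  using assms(2)
proof (induction ys rule: rev_induct)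
  case (snoc y ys)
  then have "antiderivative_tower D F (xs @ ys)" "D y \<in> field_adjoin F (set ys)"
    by (simp_all add: antiderivative_tower_snoc)
  moreover have "field_adjoin F (set ys) \<subseteq> field_adjoin F (set (xs @ ys))"
    by (rule field_adjoin_mono) auto
  ultimately show ?case
    using antiderivative_tower_snoc[of D F "xs @ ys" y] by auto
qed (use assms(1) in simp)

definition antiderivative_closure :: "('a::field \<Rightarrow> 'a) \<Rightarrow> 'a set \<Rightarrow> 'a set \<Rightarrow> 'a set" where
  "antiderivative_closure D F K =
    \<Union> {field_adjoin F (set vs) | vs. antiderivative_tower D F vs \<and> set vs \<subseteq> K}"

lemma antiderivative_closureI:
  "antiderivative_tower D F vs \<Longrightarrow> set vs \<subseteq> K \<Longrightarrow> x \<in> field_adjoin F (set vs) \<Longrightarrow>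
    x \<in> antiderivative_closure D F K"
  unfolding antiderivative_closure_def by blast

text \<open>
  The fields of towers form a directed family, since the concatenation of two towers over \<open>F\<close> is again
  a tower over \<open>F\<close>.
\<close>

lemma antiderivative_closure_finite:
  assumes "finite T" "T \<subseteq> antiderivative_closure D F K"
  obtains vs where "antiderivative_tower D F vs" "set vs \<subseteq> K" "T \<subseteq> field_adjoin F (set vs)"
proof -
  from assms have "\<exists>vs. antiderivative_tower D F vs \<and> set vs \<subseteq> K \<and> T \<subseteq> field_adjoin F (set vs)"
  proof (induction T)
    case empty
    then show ?case by (intro exI[of _ "[]"]) (simp add: antiderivative_tower_Nil)
  next
    case (insert x T)
    then obtain vs ws where vw: "antiderivative_tower D F vs" "set vs \<subseteq> K" "T \<subseteq> field_adjoin F (set vs)"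
      "antiderivative_tower D F ws" "set ws \<subseteq> K" "x \<in> field_adjoin F (set ws)"
      unfolding antiderivative_closure_def by blast
    moreover have "field_adjoin F (set vs) \<subseteq> field_adjoin F (set (vs @ ws))"
      "field_adjoin F (set ws) \<subseteq> field_adjoin F (set (vs @ ws))" by (rule field_adjoin_mono; auto)+
    ultimately show ?case
      using antiderivative_tower_append by (intro exI[of _ "vs @ ws"]) auto
  qed
  then show ?thesis using that by blast
qed

lemma antiderivative_closure_subfield:
  "is_subfield (antiderivative_closure D F K)"
proof -
  let ?M = "antiderivative_closure D F K"
  have fin: "\<exists>L. is_subfield L \<and> T \<subseteq> L \<and> L \<subseteq> ?M" if "finite T" "T \<subseteq> ?M" for T
    using antiderivative_closure_finite[OF that] is_subfield_field_adjoin antiderivative_closureI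
    by (metis subsetI)
  show ?thesis
    unfolding is_subfield_def
  proof (intro conjI ballI impI)
    obtain L where "is_subfield L" "L \<subseteq> ?M" using fin[of "{}"] by auto
    then show "0 \<in> ?M" "1 \<in> ?M" by (auto dest: subfieldD)
  next
    fix x y assume "x \<in> ?M" "y \<in> ?M"
    then obtain L where "is_subfield L" "{x, y} \<subseteq> L" "L \<subseteq> ?M" using fin[of "{x, y}"] by auto
    then show "x + y \<in> ?M" "x * y \<in> ?M" by (auto dest: subfieldD)
  next
    fix x assume "x \<in> ?M"
    then obtain L where "is_subfield L" "x \<in> L" "L \<subseteq> ?M" using fin[of "{x}"] by auto
    then show "- x \<in> ?M" "inverse x \<in> ?M" by (auto dest: subfieldD)
  qed
qed

lemma antiderivative_closure_closed:
  assumes "b \<in> K" "D b \<in> antiderivative_closure D F K"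
  shows "b \<in> antiderivative_closure D F K"
proof -
  obtain vs where vs: "antiderivative_tower D F vs" "set vs \<subseteq> K" "D b \<in> field_adjoin F (set vs)"
    using antiderivative_closure_finite[of "{D b}" D F K] assms(2) by auto
  then show ?thesis
    using assms(1) field_adjoin_superset[of F "set (vs @ [b])"]
    by (intro antiderivative_closureI[of D F "vs @ [b]"]) (auto simp: antiderivative_tower_snoc)
qed

lemma field_adjoin_single_finite:
  assumes M: "is_subfield M" and x: "x \<in> field_adjoin M {z}"
  obtains T where "finite T" "T \<subseteq> M" "\<And>L. is_subfield L \<Longrightarrow> T \<subseteq> L \<Longrightarrow> x \<in> field_adjoin L {z}"
proof -
  obtain p q where pq: "p \<in> polys_over M" "q \<in> polys_over M" "x = poly p z / poly q z"
    using field_adjoin_singleE[OF M x] by blast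
  let ?T = "set (coeffs p) \<union> set (coeffs q)"
  have "x \<in> field_adjoin L {z}" if L: "is_subfield L" "?T \<subseteq> L" for L
  proof -
    have "r \<in> polys_over L" if "set (coeffs r) \<subseteq> L" for r
    proof -
      have "coeff r i \<in> insert 0 (set (coeffs r))" for i
        using range_coeff[of r] by blast
      then have "coeff r i \<in> L" for i using that subfieldD(1)[OF L(1)] by (metis insertE subsetD)
      then show ?thesis by (simp add: polys_over_def)
    qed
    then have "p \<in> polys_over L" "q \<in> polys_over L" using L by auto
    then show ?thesis
      unfolding pq(3) using poly_in_field_adjoin subfieldD(8)[OF is_subfield_field_adjoin] by blast
  qed
  moreover have "?T \<subseteq> M" using pq by (auto simp: polys_over_def coeffs_def)
  ultimately show ?thesis using that[of ?T] by auto
qed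

text \<open>
  The inductive form of the theorem.  The base field varies in the induction and the total field \<open>E\<close>
  stays the same; the assumption on constants is inherited by larger base fields.
\<close>

lemma intermediate_field_tower:
  fixes D :: "'a::field_char_0 \<Rightarrow> 'a"
  assumes E: "differential_field D E"
    and "is_subfield F" "\<And>x. x \<in> F \<Longrightarrow> D x \<in> F" "constants D E \<subseteq> F"
    and "antiderivative_tower D F zs" "E = field_adjoin F (set zs)"
    and "is_subfield K" "K \<subseteq> E" "\<And>x. x \<in> K \<Longrightarrow> D x \<in> K" "F \<subseteq> K"
  shows "\<exists>ws. antiderivative_tower D F ws \<and> K = field_adjoin F (set ws)"
  using assms(2-)
proof (induction zs arbitrary: F K)
  case Nil
  then have "K = F" by (simp add: field_adjoin_empty)
  then show ?case
    using Nil by (intro exI[of _ "[]"]) (simp add: antiderivative_tower_Nil field_adjoin_empty)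
next
  case (Cons z zs)
  note F = Cons.prems(1,2) and K = Cons.prems(6-8) and FK = \<open>F \<subseteq> K\<close>
  have CF: "constants D E \<subseteq> F" by fact
  have Dz: "D z \<in> F" and tower: "antiderivative_tower D (field_adjoin F {z}) zs"
    using Cons.prems(4) by (simp_all add: antiderivative_tower_Cons[OF F(1)])
  have Eeq: "E = field_adjoin (field_adjoin F {z}) (set zs)"
    using Cons.prems(5) by (simp add: field_adjoin_adjoin)
  have zE: "z \<in> E" using Cons.prems(5) field_adjoin_superset[of F "set (z # zs)"] by auto
  have FE: "F \<subseteq> E" using FK K by blast
  have adj: "field_adjoin L {z} \<subseteq> E" "\<And>x. x \<in> field_adjoin L {z} \<Longrightarrow> D x \<in> field_adjoin L {z}" "L \<subseteq> field_adjoin L {z}"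
    if L: "is_subfield L" "F \<subseteq> L" "L \<subseteq> E" "\<And>x. x \<in> L \<Longrightarrow> D x \<in> L" for L
  proof -
    show sup: "L \<subseteq> field_adjoin L {z}" using field_adjoin_superset by blast
    show "field_adjoin L {z} \<subseteq> E" using subfield_E[OF E] L(3) zE by (intro field_adjoin_least) auto
    have "D z \<in> field_adjoin L {z}" using Dz L(2) sup by blast
    then show "D x \<in> field_adjoin L {z}" if "x \<in> field_adjoin L {z}" for x
      using that by - (rule field_adjoin_D_closed[OF E L(1,3) L(4) zE])
  qed
  note adjF = adj[OF F(1) order.refl FE F(2)] and adjK = adj[OF K(1) FK K(2,3)]
  obtain ws where ws: "antiderivative_tower D (field_adjoin F {z}) ws"
      "field_adjoin K {z} = field_adjoin (field_adjoin F {z}) (set ws)"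
    using Cons.IH[OF is_subfield_field_adjoin adjF(2) _ tower Eeq is_subfield_field_adjoin adjK(1,2)]
      CF adjF(3) field_adjoin_mono[OF FK order.refl] by blast
  show ?case
  proof (cases "z \<in> K")
    case True
    then have "K = field_adjoin F (set (z # ws))"
      using ws(2) K(1) by (simp add: field_adjoin_absorb field_adjoin_adjoin)
    moreover have "antiderivative_tower D F (z # ws)"
      using ws(1) Dz by (simp add: antiderivative_tower_Cons[OF F(1)])
    ultimately show ?thesis by blast
  next
    case False
    have tr: "transcendental_over K z"
      using CF FK Dz zE False by (intro antiderivative_transcendental[OF E K]) auto
    define M where "M = antiderivative_closure D F K"
    have M: "is_subfield M" unfolding M_def by (rule antiderivative_closure_subfield)
    have MK: "M \<subseteq> K"
      using K FK field_adjoin_least unfolding M_def antiderivative_closure_def by blast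
    have FM: "F \<subseteq> M"
      using antiderivative_closureI[OF antiderivative_tower_Nil] field_adjoin_empty[OF F(1)]
      unfolding M_def by fastforce
    have DzM: "D z \<in> M" using Dz FM by blast
    have closed: "b \<in> M" if "b \<in> K" "D b \<in> M" for b
      using antiderivative_closure_closed that unfolding M_def by blast
    have FzM: "field_adjoin F {z} \<subseteq> field_adjoin M {z}" using FM by (rule field_adjoin_mono) auto
    \<comment> \<open>The tower of \<open>K(z)\<close> over \<open>F(z)\<close> lies in \<open>M(z)\<close>: the derivative of each entry is in the field
      generated by the entries before it.\<close>
    have wsM: "set ws \<subseteq> field_adjoin M {z}"
    proof -
      have "ws ! i \<in> field_adjoin M {z}" if "i < length ws" for i
        using that
      proof (induction i rule: less_induct)
        case (less i)
        have "set (take i ws) \<subseteq> field_adjoin M {z}"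
          using less by (auto simp: set_conv_nth)
        then have "field_adjoin (field_adjoin F {z}) (set (take i ws)) \<subseteq> field_adjoin M {z}"
          by (rule field_adjoin_least[OF is_subfield_field_adjoin FzM])
        then have "D (ws ! i) \<in> field_adjoin M {z}"
          using ws(1) less.prems unfolding antiderivative_tower_def by blast
        moreover have "ws ! i \<in> field_adjoin K {z}"
          using ws(2) field_adjoin_superset[of "field_adjoin F {z}" "set ws"] less.prems by auto
        ultimately show ?case
          by - (rule antiderivative_closed_adjoin[OF E K M MK closed zE DzM tr])
      qed
      then show ?thesis by (auto simp: set_conv_nth)
    qed
    \<comment> \<open>A single tower over \<open>F\<close> contains all the coefficients needed to express \<open>ws\<close> in terms of \<open>z\<close>.\<close>
    have "\<exists>T. finite T \<and> T \<subseteq> M \<and> (\<forall>L. is_subfield L \<longrightarrow> T \<subseteq> L \<longrightarrow> w \<in> field_adjoin L {z})"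
      if "w \<in> set ws" for w
      using field_adjoin_single_finite[OF M, of w z] wsM that by (metis subsetD)
    then obtain T where T: "\<And>w. w \<in> set ws \<Longrightarrow> finite (T w)" "\<And>w. w \<in> set ws \<Longrightarrow> T w \<subseteq> M"
      "\<And>w L. w \<in> set ws \<Longrightarrow> is_subfield L \<Longrightarrow> T w \<subseteq> L \<Longrightarrow> w \<in> field_adjoin L {z}"
      by metis
    have "finite (\<Union>w\<in>set ws. T w)" "(\<Union>w\<in>set ws. T w) \<subseteq> antiderivative_closure D F K"
      using T(1,2) unfolding M_def by auto
    then obtain vs where vs: "antiderivative_tower D F vs" "set vs \<subseteq> K"
        "(\<Union>w\<in>set ws. T w) \<subseteq> field_adjoin F (set vs)"
      by (rule antiderivative_closure_finite)
    let ?L = "field_adjoin F (set vs)"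
    have LK: "?L \<subseteq> K" using K(1) FK vs(2) by (rule field_adjoin_least)
    have "set ws \<subseteq> field_adjoin ?L {z}"
      using T(3)[OF _ is_subfield_field_adjoin] vs(3) by blast
    moreover have "field_adjoin F {z} \<subseteq> field_adjoin ?L {z}"
      using field_adjoin_superset by (intro field_adjoin_mono) auto
    ultimately have "field_adjoin K {z} \<subseteq> field_adjoin ?L {z}"
      unfolding ws(2) by (metis field_adjoin_least is_subfield_field_adjoin)
    then have "K \<subseteq> ?L"
      using adjK(3) adjoin_transcendental_Int[OF K(1) is_subfield_field_adjoin LK tr] by blast
    with LK vs(1) show ?thesis by blast
  qed
qed

theorem theorem5p3:
  fixes D :: "'a::field_char_0 \<Rightarrow> 'a" and F E K :: "'a set"
  assumes "differential_field D F"
    and "alg_closed_subfield (constants D F)"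
    and "iterated_antiderivative_extension D F E"
    and "differential_subfield D K E"
    and "F \<subseteq> K"
  shows "iterated_antiderivative_extension D F K"
proof -
  have E: "differential_field D E" and CE: "constants D E = constants D F"
    using assms(3) by (auto simp: iterated_antiderivative_extension_def
        no_new_constants_extension_def differential_extension_def)
  obtain zs where zs: "antiderivative_tower D F zs" "E = field_adjoin F (set zs)"
    using assms(3) unfolding iterated_antiderivative_extension_def iterated_antiderivatives_def
      antiderivative_tower_def by blast
  have F: "is_subfield F" "\<And>x. x \<in> F \<Longrightarrow> D x \<in> F"
    using assms(1) by (auto simp: differential_field_def)
  have K: "is_subfield K" "K \<subseteq> E" "\<And>x. x \<in> K \<Longrightarrow> D x \<in> K"
    using assms(4) by (auto simp: differential_subfield_def)
  have "constants D E \<subseteq> F" using CE by (auto simp: constants_def)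
  then obtain ws where ws: "antiderivative_tower D F ws" "K = field_adjoin F (set ws)"
    using intermediate_field_tower[OF E F _ zs K assms(5)] by blast
  have "differential_field D K"
    using E assms(4) by (rule differential_subfield_imp_differential_field)
  moreover have "constants D K = constants D F"
    using CE K(2) assms(5) by (auto simp: constants_def)
  ultimately have "no_new_constants_extension D F K"
    using assms(1,5) by (simp add: no_new_constants_extension_def differential_extension_def)
  moreover have "set ws \<subseteq> K" using ws(2) field_adjoin_superset by blast
  ultimately show ?thesis
    using ws by (auto simp: iterated_antiderivative_extension_def iterated_antiderivatives_def
        antiderivative_tower_def)
qed

end
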